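(* Let $S^n\subset\mathbb{R}^{n+1}$ be the Euclidean unit sphere. There exists a constant $C\ge 1$ such that for every $\alpha\in S^n$ there exist infinitely many rationals $\frac{\mathbf{p}}{q}\in S^n$ such that $$\left\|\alpha-\frac{\mathbf{p}}{q}\right\|<\frac{C}{q}.$$
   Context: $\|\cdot\|$ denotes the supremum norm on $\mathbb{R}^{n+1}$. Rational points on the sphere, i.e. points of $S^n\cap\mathbb{Q}^{n+1}$, are represented as $\frac{\mathbf{p}}{q}$ with $q\in\mathbb{N}$, $\mathbf{p}\in\mathbb{Z}^{n+1}$ and $(\mathbf{p},q)$ primitive.
   Formalization: The claim is proved for n ≥ 1 and every α in S^n that is not a rational point; for rational α in S^n it is false, since only finitely many primitive p/q in S^n satisfy the inequality, whatever C is. *)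

theory Defs
  imports "HOL-Analysis.Analysis"
begin

definition ratpoint :: "int ^ 'n \<Rightarrow> nat \<Rightarrow> real ^ 'n" where
  "ratpoint p q = (\<chi> i. of_int (p $ i) / of_nat q)"

(* Each rational point has exactly one primitive representation, so counting primitive pairs
   (p, q) amounts to counting rational points. *)
definition primitive_rep :: "int ^ 'n \<Rightarrow> nat \<Rightarrow> bool" where
  "primitive_rep p q \<longleftrightarrow> q > 0 \<and> Gcd (insert (int q) (range (\<lambda>i. p $ i))) = 1"

definition rational_vecs :: "(real ^ 'n) set" where
  "rational_vecs = {x. \<forall>i. x $ i \<in> \<rat>}"

lemma primitive_rep_denominator_le:
  fixes a p :: "int ^ 'n" and b q :: nat
  assumes prim: "primitive_rep p q" and "b > 0" and eq: "ratpoint p q = ratpoint a b"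
  shows "q \<le> b"
proof -
  have q: "q > 0" using prim by (simp add: primitive_rep_def)
  have *: "p $ i * int b = a $ i * int q" for i
  proof -
    have "ratpoint p q $ i = ratpoint a b $ i" using eq by simp
    then have "real_of_int (p $ i * int b) = real_of_int (a $ i * int q)"
      using q \<open>b > 0\<close> by (simp add: ratpoint_def field_simps)
    then show ?thesis by (simp only: of_int_eq_iff)
  qed
  let ?A = "insert (int q) (range (\<lambda>i. p $ i))"
  have "int q dvd Gcd ((*) (int b) ` ?A)"
  proof (rule Gcd_greatest)
    fix y assume "y \<in> (*) (int b) ` ?A"
    then consider "y = int b * int q" | i where "y = int b * p $ i" by auto
    then show "int q dvd y"
    proof cases
      case (2 i)
      then have "y = a $ i * int q" using *[of i] by (simp add: mult.commute)
      then show ?thesis by simp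
    qed simp
  qed
  also have "Gcd ((*) (int b) ` ?A) = normalize (int b * Gcd ?A)" by (rule Gcd_mult)
  finally have "int q dvd int b" using prim by (simp add: primitive_rep_def)
  then show ?thesis using \<open>b > 0\<close> by (simp add: dvd_imp_le)
qed

lemma rational_vecs_common_denominator:
  fixes \<alpha> :: "real ^ 'n"
  assumes "\<alpha> \<in> rational_vecs"
  obtains a :: "int ^ 'n" and b :: nat where "b > 0" "\<alpha> = ratpoint a b"
proof -
  have "\<exists>m k. k > 0 \<and> \<alpha> $ i = of_int m / of_int k" for i
  proof -
    from assms have "\<alpha> $ i \<in> \<rat>" by (simp add: rational_vecs_def)
    then show ?thesis by (rule Rats_cases') blast
  qed
  then obtain m k where k: "\<And>i. k i > (0::int)" and mk: "\<And>i. \<alpha> $ i = of_int (m i) / of_int (k i)"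
    by metis
  define b where "b = nat (\<Prod>i\<in>UNIV. k i)"
  have b: "(\<Prod>i\<in>UNIV. k i) > 0" by (rule prod_pos) (use k in auto)
  define a :: "int ^ 'n" where "a = (\<chi> i. m i * (\<Prod>j\<in>UNIV - {i}. k j))"
  have "\<alpha> $ i = ratpoint a b $ i" for i
  proof -
    have s: "(\<Prod>j\<in>UNIV. k j) = k i * (\<Prod>j\<in>UNIV - {i}. k j)"
      by (rule prod.remove) auto
    have "(\<Prod>j\<in>UNIV - {i}. k j) > 0" by (rule prod_pos) (use k in auto)
    then have nz: "real_of_int (\<Prod>j\<in>UNIV - {i}. k j) \<noteq> 0" by linarith
    have "real b = real_of_int (k i) * real_of_int (\<Prod>j\<in>UNIV - {i}. k j)"
      using b unfolding b_def s by simp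
    then show ?thesis using mk[of i] nz k[of i]
      by (simp add: ratpoint_def a_def del: of_int_prod)
  qed
  then have "\<alpha> = ratpoint a b" by (simp add: vec_eq_iff)
  moreover have "b > 0" using b by (simp add: b_def)
  ultimately show ?thesis by (rule that[rotated])
qed

lemma rational_sphere_points_separated:
  fixes a p :: "int ^ 'n" and b q :: nat
  assumes "b > 0" "q > 0" and s: "ratpoint a b \<in> sphere 0 1" "ratpoint p q \<in> sphere 0 1"
    and ne: "ratpoint a b \<noteq> ratpoint p q"
  shows "2 / (real b * real q) \<le> (norm (ratpoint a b - ratpoint p q))\<^sup>2"
proof -
  let ?d = "(norm (ratpoint a b - ratpoint p q))\<^sup>2"
  define k where "k = int b * int q - (\<Sum>i\<in>UNIV. a $ i * p $ i)"
  have ip: "ratpoint a b \<bullet> ratpoint p q = real_of_int (\<Sum>i\<in>UNIV. a $ i * p $ i) / (real b * real q)"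
    by (simp add: inner_vec_def ratpoint_def sum_divide_distrib)
  have n: "ratpoint a b \<bullet> ratpoint a b = 1" "ratpoint p q \<bullet> ratpoint p q = 1"
    using s by (simp_all add: norm_eq_1)
  have "?d = 2 - 2 * (ratpoint a b \<bullet> ratpoint p q)"
    unfolding power2_norm_eq_inner using n by (simp add: inner_diff inner_commute)
  also have "\<dots> = 2 * real_of_int k / (real b * real q)"
    unfolding ip k_def using assms(1,2) by (simp add: field_simps)
  finally have d: "?d = 2 * real_of_int k / (real b * real q)" .
  have "?d > 0" using ne by simp
  then have "real_of_int k > 0"
    unfolding d using assms(1,2) by (auto simp: zero_less_divide_iff zero_less_mult_iff mult_less_0_iff)
  then have "k \<ge> 1" by linarith
  then show ?thesis unfolding d using assms(1,2) by (simp add: divide_right_mono)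
qed

(* Rational \<alpha> have to be excluded: two distinct rational points of the sphere with denominators
   b and q are at squared distance at least 2 / (b q), which for fixed b is eventually larger
   than any constant times 1 / q^2. *)
lemma finite_sphere_approximants_rational:
  fixes \<alpha> :: "real ^ 'n"
  assumes "\<alpha> \<in> sphere 0 1" and rat: "\<alpha> \<in> rational_vecs"
  shows "finite {(p, q). primitive_rep p q \<and> ratpoint p q \<in> sphere 0 1 \<and>
                        infnorm (\<alpha> - ratpoint p q) < C / real q}"
    (is "finite ?A")
proof -
  obtain a :: "int ^ 'n" and b :: nat where b: "b > 0" and \<alpha>: "\<alpha> = ratpoint a b"
    using rational_vecs_common_denominator[OF rat] .
  define Q where "Q = max b (nat \<lceil>real CARD('n) * C\<^sup>2 * real b\<rceil>)"
  have bound: "q \<le> Q \<and> (\<forall>i. \<bar>p $ i\<bar> \<le> int q)" if "(p, q) \<in> ?A" for p q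
  proof
    from that have prim: "primitive_rep p q" and s: "ratpoint p q \<in> sphere 0 1"
      and ap: "infnorm (\<alpha> - ratpoint p q) < C / real q"
      by auto
    have q: "q > 0" using prim by (simp add: primitive_rep_def)
    show "q \<le> Q"
    proof (cases "ratpoint p q = ratpoint a b")
      case True
      then show ?thesis using primitive_rep_denominator_le[OF prim b True] by (simp add: Q_def)
    next
      case False
      have "2 / (real b * real q) \<le> (norm (\<alpha> - ratpoint p q))\<^sup>2"
        unfolding \<alpha> by (rule rational_sphere_points_separated) (use b q s assms(1) \<alpha> False in auto)
      also have "\<dots> \<le> (sqrt (real CARD('n)) * infnorm (\<alpha> - ratpoint p q))\<^sup>2"
        using norm_le_infnorm[of "\<alpha> - ratpoint p q"] by (intro power_mono) auto
      also have "\<dots> \<le> (sqrt (real CARD('n)) * (C / real q))\<^sup>2"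
        using ap infnorm_pos_le[of "\<alpha> - ratpoint p q"]
        by (intro power_mono mult_left_mono mult_nonneg_nonneg) auto
      also have "\<dots> = real CARD('n) * C\<^sup>2 / (real q)\<^sup>2"
        by (simp add: power_mult_distrib power_divide)
      finally have "2 * real q \<le> real CARD('n) * C\<^sup>2 * real b"
        using b q by (simp add: field_simps power2_eq_square)
      then have "real q \<le> real CARD('n) * C\<^sup>2 * real b" by linarith
      then have "q \<le> nat \<lceil>real CARD('n) * C\<^sup>2 * real b\<rceil>" by linarith
      then show ?thesis by (simp add: Q_def)
    qed
    show "\<forall>i. \<bar>p $ i\<bar> \<le> int q"
    proof
      fix i
      have "\<bar>ratpoint p q $ i\<bar> \<le> 1"
        using component_le_norm_cart[of "ratpoint p q" i] s by simp
      then have "\<bar>real_of_int (p $ i)\<bar> \<le> real q" using q by (simp add: ratpoint_def)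
      then show "\<bar>p $ i\<bar> \<le> int q" by linarith
    qed
  qed
  have "finite (vec_lambda ` (UNIV \<rightarrow>\<^sub>E {- int Q..int Q}) \<times> {..Q} :: ((int ^ 'n) \<times> nat) set)"
    by (intro finite_cartesian_product finite_imageI finite_PiE) auto
  moreover have "?A \<subseteq> vec_lambda ` (UNIV \<rightarrow>\<^sub>E {- int Q..int Q}) \<times> {..Q}"
  proof (rule subrelI)
    fix p q assume "(p, q) \<in> ?A"
    from bound[OF this] have q: "q \<le> Q" and p: "\<And>i. \<bar>p $ i\<bar> \<le> int q" by auto
    have "p $ i \<in> {- int Q..int Q}" for i using p[of i] q by auto
    then have "vec_nth p \<in> UNIV \<rightarrow>\<^sub>E {- int Q..int Q}" by auto
    then have "p \<in> vec_lambda ` (UNIV \<rightarrow>\<^sub>E {- int Q..int Q})"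
      by (metis image_eqI vec_nth_inverse)
    then show "(p, q) \<in> vec_lambda ` (UNIV \<rightarrow>\<^sub>E {- int Q..int Q}) \<times> {..Q}" using q by simp
  qed
  ultimately show ?thesis by (rule finite_subset[rotated])
qed

end

theory Submission
  imports Defs
begin

text \<open>Rational points \<open>p / q\<close> of the sphere are integer vectors \<open>(p, q)\<close> on the light cone of the
  form \<open>|x|\<^sup>2 - t\<^sup>2\<close>, and \<open>|\<alpha> - p / q|\<^sup>2 = 2 \<delta> / q\<close> for the defect \<open>\<delta> = q - p \<bullet> \<alpha>\<close>; the
  claim is thus that \<open>q \<delta>\<close> is bounded infinitely often. Integer cone vectors of arbitrarily small defect
  exist. Among those with defect below \<open>\<epsilon>\<close> choose one of minimal \<open>q\<close>. As in Cassels' theorem on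
  small zeros of quadratic forms, if \<open>q \<delta>\<close> were large, reflecting it in an integer vector nearly
  parallel to it would produce a smaller one.\<close>

section \<open>Cone vectors and their defect\<close>

definition rvec :: "int ^ 'n \<Rightarrow> real ^ 'n" where
  "rvec p = (\<chi> i. of_int (p $ i))"

definition on_cone :: "int ^ 'n \<Rightarrow> nat \<Rightarrow> bool" where
  "on_cone p q \<longleftrightarrow> q > 0 \<and> rvec p \<bullet> rvec p = (real q)\<^sup>2"

text \<open>Up to sign, this is the product of \<open>(p, q)\<close> with the isotropic vector
  \<open>(\<alpha>, 1)\<close> in the form \<open>|x|^2 - t^2\<close>.\<close>

definition defect :: "real ^ 'n \<Rightarrow> int ^ 'n \<Rightarrow> nat \<Rightarrow> real" where
  "defect \<alpha> p q = real q - rvec p \<bullet> \<alpha>"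

lemma ratpoint_eq_rvec: "ratpoint p q = (1 / real q) *\<^sub>R rvec p"
  by (simp add: ratpoint_def rvec_def vec_eq_iff)

lemma on_cone_ratpoint_sphere:
  assumes "on_cone p q"
  shows "ratpoint p q \<in> sphere 0 1"
proof -
  have "ratpoint p q \<bullet> ratpoint p q = 1"
    using assms by (simp add: ratpoint_eq_rvec on_cone_def power2_eq_square)
  then show ?thesis by (simp add: norm_eq_1)
qed

lemma norm_diff_ratpoint:
  fixes \<alpha> :: "real ^ 'n"
  assumes "on_cone p q" "\<alpha> \<in> sphere 0 1"
  shows "(norm (\<alpha> - ratpoint p q))\<^sup>2 = 2 * defect \<alpha> p q / real q"
proof -
  have "\<alpha> \<bullet> \<alpha> = 1" "ratpoint p q \<bullet> ratpoint p q = 1" "q > 0"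
    using assms on_cone_ratpoint_sphere[OF assms(1)] by (simp_all add: norm_eq_1 on_cone_def)
  moreover have "rvec p \<bullet> \<alpha> = real q * (ratpoint p q \<bullet> \<alpha>)"
    using \<open>q > 0\<close> by (simp add: ratpoint_eq_rvec)
  ultimately show ?thesis
    by (simp add: power2_norm_eq_inner inner_diff inner_commute defect_def field_simps)
qed

text \<open>Irrationality of \<open>\<alpha>\<close> enters here: it keeps \<open>\<alpha>\<close>
  at positive distance from every rational point, and the defect is a positive multiple of the
  squared distance.\<close>

lemma defect_pos:
  fixes \<alpha> :: "real ^ 'n"
  assumes "on_cone p q" "\<alpha> \<in> sphere 0 1" "\<alpha> \<notin> rational_vecs"
  shows "defect \<alpha> p q > 0"
proof -
  have "ratpoint p q \<in> rational_vecs"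
    by (simp add: rational_vecs_def ratpoint_def)
  then have "(norm (\<alpha> - ratpoint p q))\<^sup>2 > 0"
    using assms(3) by auto
  moreover have "q > 0" using assms(1) by (simp add: on_cone_def)
  ultimately show ?thesis
    unfolding norm_diff_ratpoint[OF assms(1,2)] by (simp add: zero_less_divide_iff)
qed

section \<open>Reflections and pigeonholing\<close>

text \<open>The reflection of the isotropic vector \<open>(p, q)\<close> in \<open>(y, s)\<close>, scaled by the value of the
  form at \<open>(y, s)\<close>, so that it stays integral.\<close>

lemma on_cone_reflect:
  fixes p y :: "int ^ 'n" and q :: nat and s :: int and Q B :: real
  assumes "on_cone p q"
    and Q: "Q = rvec y \<bullet> rvec y - (real_of_int s)\<^sup>2"
    and B: "B = rvec p \<bullet> rvec y - real q * real_of_int s"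
    and pos: "Q * real q - 2 * B * real_of_int s > 0"
  obtains p' q' where "on_cone p' q'" "rvec p' = Q *\<^sub>R rvec p - (2 * B) *\<^sub>R rvec y"
    "real q' = Q * real q - 2 * B * real_of_int s"
proof -
  \<comment> \<open>\<open>Q\<close> and \<open>B\<close> are integers in disguise; their integer
    versions make the reflected vector integral.\<close>
  define Qi where "Qi = (\<Sum>i\<in>UNIV. y $ i * y $ i) - s\<^sup>2"
  define Bi where "Bi = (\<Sum>i\<in>UNIV. p $ i * y $ i) - int q * s"
  have Qi: "Q = of_int Qi" and Bi: "B = of_int Bi"
    by (simp_all add: Q B Qi_def Bi_def inner_vec_def rvec_def)
  define p' where "p' = (\<chi> i. Qi * p $ i - 2 * Bi * y $ i)"
  define q' where "q' = nat (Qi * int q - 2 * Bi * s)"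
  have p': "rvec p' = Q *\<^sub>R rvec p - (2 * B) *\<^sub>R rvec y"
    by (simp add: p'_def rvec_def vec_eq_iff Qi Bi)
  have "real_of_int (Qi * int q - 2 * Bi * s) > 0"
    using pos by (simp add: Qi Bi)
  then have "Qi * int q - 2 * Bi * s > 0"
    by (simp only: of_int_0_less_iff)
  then have q': "real q' = Q * real q - 2 * B * real_of_int s" "q' > 0"
    by (simp_all add: q'_def Qi Bi)
  have iso: "rvec p \<bullet> rvec p = (real q)\<^sup>2" using assms(1) by (simp add: on_cone_def)
  have py: "rvec p \<bullet> rvec y = B + real q * s" and yy: "rvec y \<bullet> rvec y = Q + (real_of_int s)\<^sup>2"
    by (simp_all add: Q B)
  have "rvec p' \<bullet> rvec p' = (real q')\<^sup>2"
    unfolding p' q'(1)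
    by (simp add: inner_diff inner_commute[of "rvec y" "rvec p"] iso py yy)
       (simp add: algebra_simps power2_eq_square)
  then show ?thesis using that p' q' by (simp add: on_cone_def)
qed

text \<open>Dirichlet's box principle for the fractional parts of the multiples of \<open>a\<close>.
  Cells are cubes of side \<open>1 / k\<close> cut into slabs of thickness \<open>\<kappa>\<close>
  orthogonal to \<open>u\<close>: the cubes make the remainder short, the slabs make its component
  along \<open>u\<close> much smaller still.\<close>

lemma slab_pigeonhole:
  fixes a u :: "real ^ 'n" and q k :: nat and \<kappa> :: real
  assumes u: "norm u \<le> 1" and "\<kappa> > 0" "k > 0"
    and q: "real k ^ CARD('n) * (2 * real CARD('n) / \<kappa> + 5) < real q"
  obtains s :: nat and y :: "int ^ 'n" where "0 < s" "s < q"
    "\<And>i. \<bar>(real s *\<^sub>R a - rvec y) $ i\<bar> < 1 / real k" "\<bar>u \<bullet> (real s *\<^sub>R a - rvec y)\<bar> < \<kappa>"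
proof -
  have floor_close: "\<bar>x - y\<bar> < 1" if "\<lfloor>x\<rfloor> = \<lfloor>y\<rfloor>" for x y :: real
    using that by linarith
  define x where "x s = (\<chi> i. frac (real s * a $ i))" for s :: nat
  define M where "M = \<lceil>real CARD('n) / \<kappa>\<rceil> + 1"
  define f where "f s = ((\<lambda>i. \<lfloor>real k * x s $ i\<rfloor>), \<lfloor>(u \<bullet> x s) / \<kappa>\<rfloor>)" for s
  let ?F = "(UNIV \<rightarrow>\<^sub>E {0..<int k}) \<times> {-M..M} :: (('n \<Rightarrow> int) \<times> int) set"
  have M: "M \<ge> 0" "real_of_int M \<le> real CARD('n) / \<kappa> + 2"
    using \<open>\<kappa> > 0\<close> unfolding M_def by (auto intro!: add_nonneg_nonneg simp: less_le_trans[of "-1" 0]) linarith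
  have sub: "f ` {..<q} \<subseteq> ?F"
  proof
    fix c assume "c \<in> f ` {..<q}"
    then obtain s where c: "c = f s" by auto
    have 1: "0 \<le> x s $ i" "x s $ i < 1" for i
      by (simp_all add: x_def frac_lt_1)
    have "0 \<le> \<lfloor>real k * x s $ i\<rfloor> \<and> \<lfloor>real k * x s $ i\<rfloor> < int k" for i
      using 1[of i] \<open>k > 0\<close> by (simp add: floor_less_iff)
    moreover have "\<bar>u \<bullet> x s\<bar> \<le> real CARD('n)"
    proof -
      have "norm (x s) \<le> (\<Sum>i\<in>UNIV. \<bar>x s $ i\<bar>)" by (rule norm_le_l1_cart)
      also have "\<dots> \<le> (\<Sum>i\<in>(UNIV::'n set). 1)"
        by (rule sum_mono) (use 1 in \<open>simp add: less_imp_le\<close>)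
      finally have "norm (x s) \<le> real CARD('n)" by simp
      then have "norm u * norm (x s) \<le> 1 * real CARD('n)"
        using u by (intro mult_mono) auto
      then show ?thesis using Cauchy_Schwarz_ineq2[of u "x s"] by linarith
    qed
    then have "\<bar>(u \<bullet> x s) / \<kappa>\<bar> \<le> real CARD('n) / \<kappa>"
      using \<open>\<kappa> > 0\<close> by (simp add: divide_right_mono)
    then have "-M \<le> \<lfloor>(u \<bullet> x s) / \<kappa>\<rfloor> \<and> \<lfloor>(u \<bullet> x s) / \<kappa>\<rfloor> \<le> M"
      unfolding M_def by linarith
    ultimately show "c \<in> ?F" unfolding c f_def by auto
  qed
  \<comment> \<open>The 5 in the hypothesis on \<open>q\<close> arises from \<open>2 * M + 1\<close>
    with \<open>M\<close> at most \<open>d / \<kappa> + 2\<close>, where \<open>d\<close> is the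
    dimension.\<close>
  have "real (card ?F) = real k ^ CARD('n) * (2 * real_of_int M + 1)"
    using M(1) by (simp add: card_cartesian_product card_PiE)
  also have "\<dots> \<le> real k ^ CARD('n) * (2 * real CARD('n) / \<kappa> + 5)"
    using M(2) by (intro mult_left_mono) auto
  finally have "card ?F < q" using q by linarith
  moreover have "finite ?F" by (intro finite_cartesian_product finite_PiE) auto
  ultimately have "card (f ` {..<q}) < card {..<q}"
    using card_mono[OF _ sub] by simp
  from pigeonhole[OF this] obtain s t where "s < q" "t < q" "s \<noteq> t" "f s = f t"
    by (auto simp: inj_on_def)
  then obtain s t where st: "s < t" "t < q" "f t = f s"
    by (metis linorder_neqE_nat)
  define y :: "int ^ 'n" where "y = (\<chi> i. \<lfloor>real t * a $ i\<rfloor> - \<lfloor>real s * a $ i\<rfloor>)"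
  have w: "real (t - s) *\<^sub>R a - rvec y = x t - x s"
    using st(1) by (simp add: vec_eq_iff y_def rvec_def x_def frac_def of_nat_diff algebra_simps)
  show ?thesis
  proof (rule that[of "t - s" y])
    show "\<bar>(real (t - s) *\<^sub>R a - rvec y) $ i\<bar> < 1 / real k" for i
    proof -
      have "\<lfloor>real k * x t $ i\<rfloor> = \<lfloor>real k * x s $ i\<rfloor>"
        using st(3) by (simp add: f_def fun_eq_iff)
      from floor_close[OF this] have "\<bar>real k * (x t $ i - x s $ i)\<bar> < 1"
        by (simp add: right_diff_distrib)
      then show ?thesis unfolding w abs_mult using \<open>k > 0\<close> by (simp add: field_simps)
    qed
    have "\<lfloor>(u \<bullet> x t) / \<kappa>\<rfloor> = \<lfloor>(u \<bullet> x s) / \<kappa>\<rfloor>"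
      using st(3) by (simp add: f_def)
    from floor_close[OF this] have "\<bar>(u \<bullet> (x t - x s)) / \<kappa>\<bar> < 1"
      by (simp add: inner_diff_right diff_divide_distrib)
    then show "\<bar>u \<bullet> (real (t - s) *\<^sub>R a - rvec y)\<bar> < \<kappa>"
      unfolding w using \<open>\<kappa> > 0\<close> by (simp add: abs_divide)
  qed (use st in auto)
qed

section \<open>Existence of small defects\<close>

text \<open>Reflecting the cone vector \<open>(axis k 1, 1)\<close> in a simultaneous Dirichlet approximation of
  \<open>(\<alpha>, 1)\<close> is stereographic projection in disguise.\<close>

lemma on_cone_small_defect:
  fixes \<alpha> :: "real ^ 'n"
  assumes \<alpha>: "\<alpha> \<in> sphere 0 1" "\<alpha> \<notin> rational_vecs" and "\<epsilon> > 0"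
  obtains p q where "on_cone p q" "defect \<alpha> p q < \<epsilon>"
proof -
  let ?d = "real CARD('n)"
  \<comment> \<open>\<open>undefined\<close> merely selects some coordinate; any rational base point
    of the projection would do.\<close>
  define b :: "int ^ 'n" where "b = axis undefined 1"
  have rb: "rvec b = axis undefined 1"
    by (simp add: b_def rvec_def axis_def vec_eq_iff)
  have b: "on_cone b 1" by (simp add: on_cone_def rb inner_axis_axis)
  have nb: "norm (rvec b) = 1" by (simp add: rb)
  have n\<alpha>: "norm \<alpha> = 1" "\<alpha> \<bullet> \<alpha> = 1" using \<alpha> by (simp_all add: norm_eq_1)
  have "\<alpha> \<noteq> rvec b"
    using \<alpha>(2) by (auto simp: rational_vecs_def rvec_def)
  then have ne: "norm (\<alpha> - rvec b) > 0" by simp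
  \<comment> \<open>The three bounds on the error \<open>e\<close> serve, in order, to replace
    \<open>norm e\<close> squared by \<open>norm e\<close>, to bring the defect below
    \<open>\<epsilon>\<close>, and to keep the new denominator nonzero.\<close>
  define \<eta> where "\<eta> = min (min 1 (\<epsilon> / 4)) (norm (\<alpha> - rvec b))"
  have "\<eta> > 0" using ne \<open>\<epsilon> > 0\<close> by (simp add: \<eta>_def)
  obtain N :: nat where N: "real N > ?d / \<eta>"
    using reals_Archimedean2 by blast
  have "?d / \<eta> > 0" using \<open>\<eta> > 0\<close> by simp
  then have "N > 0" using N by (metis of_nat_0_less_iff less_trans)
  obtain g :: "'n \<Rightarrow> nat" where g: "bij_betw g UNIV {0..<CARD('n)}"
    using ex_bij_betw_finite_nat[of "UNIV :: 'n set"] by auto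
  obtain m :: int and r where m: "m > 0"
    and r: "\<And>i. i < CARD('n) \<Longrightarrow> \<bar>of_int m * \<alpha> $ (inv g i) - of_int (r i)\<bar> < 1 / real N"
    using Dirichlet_approx_simult[OF \<open>N > 0\<close>, of "CARD('n)" "\<lambda>i. \<alpha> $ (inv g i)"] by metis
  define y :: "int ^ 'n" where "y = (\<chi> i. r (g i))"
  define e where "e = rvec y - of_int m *\<^sub>R \<alpha>"
  have e: "\<bar>e $ i\<bar> < 1 / real N" for i
  proof -
    have "g i < CARD('n)" using g by (auto simp: bij_betw_def)
    moreover have "inv g (g i) = i" using g by (simp add: bij_betw_def)
    ultimately show ?thesis using r[of "g i"] by (simp add: e_def y_def rvec_def abs_minus_commute)
  qed
  have "norm e \<le> (\<Sum>i\<in>UNIV. \<bar>e $ i\<bar>)" by (rule norm_le_l1_cart)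
  also have "\<dots> \<le> (\<Sum>i\<in>(UNIV::'n set). 1 / real N)"
    by (rule sum_mono) (use e in \<open>simp add: less_imp_le\<close>)
  finally have "norm e \<le> ?d / real N" by simp
  also have "\<dots> < \<eta>" using N \<open>\<eta> > 0\<close> \<open>N > 0\<close> by (simp add: field_simps)
  finally have small: "norm e < 1" "norm e < \<epsilon> / 4" "norm e < norm (\<alpha> - rvec b)"
    by (simp_all add: \<eta>_def)
  have y: "rvec y = of_int m *\<^sub>R \<alpha> + e" by (simp add: e_def)
  define Q where "Q = rvec y \<bullet> rvec y - (real_of_int m)\<^sup>2"
  define B where "B = rvec b \<bullet> rvec y - real 1 * real_of_int m"
  have bb: "rvec b \<bullet> rvec b = 1" using nb by (simp add: norm_eq_1)
  have Q: "Q = 2 * of_int m * (e \<bullet> \<alpha>) + e \<bullet> e"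
    by (simp add: Q_def y inner_add n\<alpha> inner_commute[of \<alpha> e] power2_eq_square algebra_simps)
  have B: "B = of_int m * (rvec b \<bullet> \<alpha>) + rvec b \<bullet> e - of_int m"
    by (simp add: B_def y inner_add)
  \<comment> \<open>The new denominator is the squared length of \<open>rvec y - m b\<close>, hence
    positive unless this vector vanishes.\<close>
  have "Q * real 1 - 2 * B * of_int m = (norm (of_int m *\<^sub>R (\<alpha> - rvec b) + e))\<^sup>2"
    unfolding power2_norm_eq_inner Q B
    by (simp add: inner_add inner_diff inner_commute[of \<alpha> e] inner_commute[of \<alpha> "rvec b"]
        inner_commute[of e "rvec b"] n\<alpha> bb algebra_simps)
  moreover have "of_int m *\<^sub>R (\<alpha> - rvec b) + e \<noteq> 0"
  proof
    assume "of_int m *\<^sub>R (\<alpha> - rvec b) + e = 0"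
    then have "norm e = norm (of_int m *\<^sub>R (\<alpha> - rvec b))"
      by (metis add_eq_0_iff norm_minus_cancel)
    also have "\<dots> = of_int m * norm (\<alpha> - rvec b)" using m by simp
    also have "\<dots> \<ge> 1 * norm (\<alpha> - rvec b)" using m by (intro mult_right_mono) auto
    finally show False using small(3) by simp
  qed
  ultimately have pos: "Q * real 1 - 2 * B * real_of_int m > 0" by simp
  obtain p' q' where p': "on_cone p' q'" "rvec p' = Q *\<^sub>R rvec b - (2 * B) *\<^sub>R rvec y"
    "real q' = Q * real 1 - 2 * B * real_of_int m"
    using on_cone_reflect[OF b Q_def B_def pos] by metis
  \<comment> \<open>All terms containing \<open>m\<close> cancel, so the defect is quadratic in
    \<open>e\<close> however large \<open>m\<close> is.\<close>
  have "defect \<alpha> p' q' = (1 - rvec b \<bullet> \<alpha>) * (e \<bullet> e) + 2 * ((rvec b \<bullet> e) * (e \<bullet> \<alpha>))"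
    unfolding defect_def p'(2,3) y
    by (simp add: inner_add inner_diff n\<alpha>) (simp add: Q B algebra_simps)
  also have "\<dots> \<le> 2 * (norm e)\<^sup>2 + 2 * (norm e * norm e)"
  proof -
    have "\<bar>rvec b \<bullet> \<alpha>\<bar> \<le> 1" "\<bar>rvec b \<bullet> e\<bar> \<le> norm e" "\<bar>e \<bullet> \<alpha>\<bar> \<le> norm e"
      using Cauchy_Schwarz_ineq2[of "rvec b" \<alpha>] Cauchy_Schwarz_ineq2[of "rvec b" e]
        Cauchy_Schwarz_ineq2[of e \<alpha>] nb n\<alpha> by simp_all
    moreover from this have "\<bar>(rvec b \<bullet> e) * (e \<bullet> \<alpha>)\<bar> \<le> norm e * norm e"
      unfolding abs_mult by (intro mult_mono) auto
    moreover have "(1 - rvec b \<bullet> \<alpha>) * (e \<bullet> e) \<le> 2 * (e \<bullet> e)"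
      using calculation(1) by (intro mult_right_mono) auto
    ultimately show ?thesis by (simp add: power2_norm_eq_inner)
  qed
  also have "\<dots> = 4 * norm e * norm e" by (simp add: power2_eq_square)
  also have "\<dots> \<le> 4 * norm e * 1" using small(1) by (intro mult_left_mono) auto
  also have "\<dots> < \<epsilon>" using small(2) by simp
  finally show ?thesis using that p'(1) by blast
qed


section \<open>Descent from a minimal cone vector\<close>

text \<open>If \<open>(p, q)\<close> violates the bound, pigeonholing the multiples of \<open>p / q\<close> modulo 1 into cells that
  are thin in the direction of \<open>p / q + \<alpha>\<close> yields an integer vector \<open>(s / q) (p, q) - (w, 0)\<close> with
  \<open>w\<close> short. Reflecting \<open>(p, q)\<close> in it gives denominator \<open>|w|\<^sup>2 q\<close> and does not increase the defect.\<close>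

lemma minimal_defect_bound:
  fixes \<alpha> :: "real ^ 'n"
  defines "K \<equiv> real (2 * CARD('n)) ^ CARD('n) * (4 * real CARD('n) + 5)"
  assumes \<alpha>: "\<alpha> \<in> sphere 0 1" "\<alpha> \<notin> rational_vecs" and "\<epsilon> \<le> 1"
    and pq: "on_cone p q" "defect \<alpha> p q < \<epsilon>"
    and min: "\<And>p' q'. on_cone p' q' \<Longrightarrow> defect \<alpha> p' q' < \<epsilon> \<Longrightarrow> q \<le> q'"
  shows "real q * defect \<alpha> p q \<le> K\<^sup>2"
proof (rule ccontr)
  let ?d = "real CARD('n)"
  define a where "a = ratpoint p q"
  define \<delta> where "\<delta> = defect \<alpha> p q"
  \<comment> \<open>Chosen so that \<open>\<kappa>^2 = \<delta> / (4 q)\<close>, which limits the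
    second term of the new defect to \<open>\<delta> / 2\<close>.\<close>
  define \<kappa> where "\<kappa> = sqrt (\<delta> / real q) / 2"
  assume "\<not> real q * defect \<alpha> p q \<le> K\<^sup>2"
  then have K: "K\<^sup>2 < real q * \<delta>" by (simp add: \<delta>_def)
  have \<delta>: "0 < \<delta>" "\<delta> < \<epsilon>" "\<delta> < 1"
    using defect_pos[OF pq(1) \<alpha>] pq(2) \<open>\<epsilon> \<le> 1\<close> by (simp_all add: \<delta>_def)
  have q: "q > 0" and iso: "rvec p \<bullet> rvec p = (real q)\<^sup>2" using pq(1) by (simp_all add: on_cone_def)
  have pa: "rvec p = real q *\<^sub>R a" using q by (simp add: a_def ratpoint_eq_rvec)
  have "norm a = 1" "norm \<alpha> = 1" "\<alpha> \<bullet> \<alpha> = 1"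
    using on_cone_ratpoint_sphere[OF pq(1)] \<alpha>(1) by (simp_all add: a_def norm_eq_1)
  define u where "u = (1/2) *\<^sub>R (a + \<alpha>)"
  have u: "norm u \<le> 1"
    using norm_triangle_ineq[of a \<alpha>] \<open>norm a = 1\<close> \<open>norm \<alpha> = 1\<close> by (simp add: u_def)
  have "\<kappa> > 0" using \<delta> q by (simp add: \<kappa>_def)
  define R where "R = sqrt (real q / \<delta>)"
  have "R > 0" using \<delta> q by (simp add: R_def)
  have R\<kappa>: "1 / \<kappa> = 2 * R" by (simp add: \<kappa>_def R_def real_sqrt_divide)
  have "1 \<le> real q / \<delta>" using \<delta> q by (simp add: field_simps)
  then have "R \<ge> 1" by (simp add: R_def)
  have "K \<ge> 0" by (simp add: K_def)
  have "(K * R)\<^sup>2 = K\<^sup>2 * (real q / \<delta>)"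
    using \<delta> by (simp add: power_mult_distrib R_def)
  also have "\<dots> < real q * \<delta> * (real q / \<delta>)" using K \<delta> q by (intro mult_strict_right_mono) auto
  also have "\<dots> = (real q)\<^sup>2" using \<delta> by (simp add: power2_eq_square)
  finally have KR: "K * R < real q" by (rule power2_less_imp_less) simp
  \<comment> \<open>The cell count is at most \<open>K * R\<close>, since \<open>R \<ge> 1\<close>
    absorbs the 5; the assumed violation says exactly \<open>K * R < q\<close>. Side
    \<open>1 / (2 d)\<close> is taken to get \<open>norm w \<le> 1 / 2\<close>.\<close>
  have "real (2 * CARD('n)) ^ CARD('n) * (2 * ?d / \<kappa> + 5)
      = real (2 * CARD('n)) ^ CARD('n) * (4 * ?d * R + 5)"
    using R\<kappa> by (simp add: divide_inverse)
  also have "\<dots> \<le> real (2 * CARD('n)) ^ CARD('n) * ((4 * ?d + 5) * R)"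
    using \<open>R \<ge> 1\<close> by (intro mult_left_mono) (auto simp: algebra_simps)
  also have "\<dots> < real q" using KR by (simp add: K_def mult.assoc)
  finally have count: "real (2 * CARD('n)) ^ CARD('n) * (2 * ?d / \<kappa> + 5) < real q" .
  have "2 * CARD('n) > 0" by simp
  obtain s y where s: "0 < s" "s < q"
    and w: "\<And>i. \<bar>(real s *\<^sub>R a - rvec y) $ i\<bar> < 1 / real (2 * CARD('n))"
    and uw: "\<bar>u \<bullet> (real s *\<^sub>R a - rvec y)\<bar> < \<kappa>"
    using slab_pigeonhole[OF u \<open>\<kappa> > 0\<close> \<open>2 * CARD('n) > 0\<close> count] by metis
  define w where "w = real s *\<^sub>R a - rvec y"
  define \<sigma> where "\<sigma> = real s / real q"
  have y: "rvec y = \<sigma> *\<^sub>R rvec p - w" using q by (simp add: w_def \<sigma>_def pa)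
  have sq: "real s = \<sigma> * real q" using q by (simp add: \<sigma>_def)
  have \<sigma>: "0 < \<sigma>" "\<sigma> < 1" using s q by (simp_all add: \<sigma>_def)
  have "norm w \<le> (\<Sum>i\<in>UNIV. \<bar>w $ i\<bar>)" by (rule norm_le_l1_cart)
  also have "\<dots> \<le> (\<Sum>i\<in>(UNIV::'n set). 1 / real (2 * CARD('n)))"
    by (rule sum_mono) (use w in \<open>simp add: w_def less_imp_le\<close>)
  finally have "norm w \<le> 1 / 2" by simp
  then have "(norm w)\<^sup>2 \<le> (1 / 2)\<^sup>2" by (intro power_mono) auto
  then have ww: "w \<bullet> w \<le> 1 / 4" unfolding power2_norm_eq_inner by (simp add: power2_eq_square)
  \<comment> \<open>Otherwise \<open>(y, s)\<close> is itself a cone vector, a proper fraction of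
    \<open>(p, q)\<close>, contradicting minimality.\<close>
  have "w \<noteq> 0"
  proof
    assume "w = 0"
    then have ys: "rvec y = \<sigma> *\<^sub>R rvec p" using y by simp
    have "on_cone y s"
      using s(1) by (simp add: on_cone_def ys iso sq power2_eq_square)
    moreover have "defect \<alpha> y s = \<sigma> * \<delta>"
      by (simp add: defect_def \<delta>_def ys sq right_diff_distrib)
    moreover have "\<sigma> * \<delta> < \<epsilon>"
      using mult_strict_right_mono[OF \<sigma>(2) \<delta>(1)] \<delta>(2) by simp
    ultimately show False using min[of y s] s by simp
  qed
  then have ww0: "w \<bullet> w > 0" by simp
  define Q where "Q = rvec y \<bullet> rvec y - (real_of_int (int s))\<^sup>2"
  define B where "B = rvec p \<bullet> rvec y - real q * real_of_int (int s)"
  have Q: "Q = w \<bullet> w - 2 * \<sigma> * (rvec p \<bullet> w)"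
    unfolding Q_def y inner_diff_left inner_diff_right inner_scaleR_left inner_scaleR_right iso
      inner_commute[of w "rvec p"] of_int_of_nat_eq sq
    by (simp add: power2_eq_square right_diff_distrib mult_ac)
  have B: "B = - (rvec p \<bullet> w)"
    unfolding B_def y inner_diff_right inner_scaleR_right iso by (simp add: sq power2_eq_square)
  have den: "Q * real q - 2 * B * real_of_int (int s) = (w \<bullet> w) * real q"
    unfolding Q B of_int_of_nat_eq sq by (simp add: left_diff_distrib)
  have pos: "Q * real q - 2 * B * real_of_int (int s) > 0"
    unfolding den using ww0 q by simp
  obtain p' q' where p': "on_cone p' q'" "rvec p' = Q *\<^sub>R rvec p - (2 * B) *\<^sub>R rvec y"
    "real q' = (w \<bullet> w) * real q"
    using on_cone_reflect[OF pq(1) Q_def B_def pos] den by metis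
  have "defect \<alpha> p' q' = (w \<bullet> w) * \<delta> + 2 * real q * ((a \<bullet> w) * (\<alpha> \<bullet> w))"
    unfolding defect_def \<delta>_def p'(2,3) y
    by (simp add: inner_diff Q B pa inner_commute[of w \<alpha>] algebra_simps)
  also have "\<dots> \<le> (1 / 4) * \<delta> + 2 * real q * (\<delta> / (4 * real q))"
  proof (intro add_mono mult_right_mono mult_left_mono)
    \<comment> \<open>Arithmetic-geometric mean inequality, the reason for taking \<open>u\<close>
      as the midpoint of \<open>a\<close> and \<open>\<alpha>\<close>.\<close>
    have "(a \<bullet> w) * (\<alpha> \<bullet> w) \<le> (u \<bullet> w)\<^sup>2"
      using zero_le_power2[of "a \<bullet> w - \<alpha> \<bullet> w"]
      by (simp add: u_def inner_add_left power2_eq_square algebra_simps)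
    also have "\<dots> \<le> \<kappa>\<^sup>2" using uw \<open>\<kappa> > 0\<close>
      by (metis abs_le_square_iff abs_of_pos less_imp_le w_def)
    also have "\<dots> = \<delta> / (4 * real q)" using \<delta> by (simp add: \<kappa>_def power_divide)
    finally show "(a \<bullet> w) * (\<alpha> \<bullet> w) \<le> \<delta> / (4 * real q)" .
  qed (use ww \<delta> in auto)
  also have "\<dots> < \<epsilon>" using \<delta> q by simp
  finally have "q \<le> q'" using min[OF p'(1)] by simp
  then have "1 * real q \<le> (w \<bullet> w) * real q" using p'(3) by simp
  then show False using ww q by simp
qed

text \<open>Dividing by the common divisor divides the positive defect as well, so the quotient
  still competes with \<open>(p, q)\<close>.\<close>

lemma minimal_primitive:
  fixes \<alpha> :: "real ^ 'n"
  assumes \<alpha>: "\<alpha> \<in> sphere 0 1" "\<alpha> \<notin> rational_vecs"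
    and pq: "on_cone p q" "defect \<alpha> p q < \<epsilon>"
    and min: "\<And>p' q'. on_cone p' q' \<Longrightarrow> defect \<alpha> p' q' < \<epsilon> \<Longrightarrow> q \<le> q'"
  shows "primitive_rep p q"
proof -
  have q: "q > 0" using pq(1) by (simp add: on_cone_def)
  define g where "g = Gcd (insert (int q) (range (\<lambda>i. p $ i)))"
  have gq: "g dvd int q" and gp: "g dvd p $ i" for i
    unfolding g_def by (rule Gcd_dvd; simp)+
  have "g \<ge> 0" unfolding g_def by simp
  with gq q have g: "g > 0" by (cases "g = 0") auto
  define q' where "q' = nat (int q div g)"
  define p' where "p' = (\<chi> i. p $ i div g)"
  have "int q = g * int q'" using gq g by (simp add: q'_def pos_imp_zdiv_nonneg_iff)
  then have q': "real q = of_int g * real q'"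
    by (metis of_int_mult of_int_of_nat_eq)
  have p': "rvec p = of_int g *\<^sub>R rvec p'"
  proof -
    have "p $ i = g * (p' $ i)" for i using gp[of i] by (simp add: p'_def)
    then show ?thesis by (simp add: rvec_def vec_eq_iff)
  qed
  have c: "on_cone p' q'"
    using pq(1) g by (auto simp: on_cone_def p' q' power2_eq_square) (use q q' in \<open>cases "q' = 0"; simp\<close>)
  have "defect \<alpha> p q = of_int g * defect \<alpha> p' q'"
    by (simp add: defect_def p' q' right_diff_distrib)
  moreover have "1 * defect \<alpha> p' q' \<le> of_int g * defect \<alpha> p' q'"
    using defect_pos[OF c \<alpha>] g by (intro mult_right_mono) auto
  ultimately have "q \<le> q'" using pq(2) by (intro min[OF c]) linarith
  then have "of_int g * real q' \<le> 1 * real q'" using q' by simp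
  moreover have "q' > 0" using c by (simp add: on_cone_def)
  ultimately have "g \<le> 1" by (simp add: mult_le_cancel_right)
  then have "g = 1" using g by simp
  then show ?thesis using q by (simp add: primitive_rep_def g_def)
qed

theorem theorem1p1:
  assumes "CARD('n::finite) \<ge> 2"
  shows "\<exists>C::real. C \<ge> 1 \<and>
    (\<forall>\<alpha> :: real ^ 'n. \<alpha> \<in> sphere 0 1 \<longrightarrow> \<alpha> \<notin> rational_vecs \<longrightarrow>
       infinite {(p, q). primitive_rep p q \<and> ratpoint p q \<in> sphere 0 1 \<and>
                         infnorm (\<alpha> - ratpoint p q) < C / real q})"
proof -
  define K where "K = real (2 * CARD('n)) ^ CARD('n) * (4 * real CARD('n) + 5)"
  have "real (2 * CARD('n)) ^ CARD('n) \<ge> 1" using assms by (intro one_le_power) linarith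
  then have "1 * 1 \<le> K" unfolding K_def by (intro mult_mono) auto
  then have K: "K \<ge> 1" by simp
  have "infinite {(p, q). primitive_rep p q \<and> ratpoint p q \<in> sphere 0 1 \<and>
                         infnorm (\<alpha> - ratpoint p q) < 2 * K / real q}" (is "infinite ?A")
    if \<alpha>: "\<alpha> \<in> sphere 0 1" "\<alpha> \<notin> rational_vecs" for \<alpha> :: "real ^ 'n"
  proof
    assume fin: "finite ?A"
    \<comment> \<open>If only finitely many approximants existed, \<open>\<epsilon>\<close> could be
      put below or at all their defects; the minimal vector of defect below
      \<open>\<epsilon>\<close> is then a new approximant. The inserted 1 covers empty
      \<open>D\<close> and gives \<open>\<epsilon> \<le> 1\<close>.\<close>
    define D where "D = (\<lambda>(p, q). defect \<alpha> p q) ` {(p, q) \<in> ?A. on_cone p q}"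
    define \<epsilon> where "\<epsilon> = Min (insert 1 D)"
    have "finite D" unfolding D_def by (intro finite_imageI finite_subset[OF _ fin]) auto
    then have \<epsilon>: "\<epsilon> > 0" "\<epsilon> \<le> 1" "\<And>x. x \<in> D \<Longrightarrow> \<epsilon> \<le> x"
      unfolding \<epsilon>_def using defect_pos[OF _ \<alpha>] by (auto simp: D_def)
    define P where "P q \<longleftrightarrow> (\<exists>p. on_cone p q \<and> defect \<alpha> p q < \<epsilon>)" for q
    have "\<exists>q. P q" using on_cone_small_defect[OF \<alpha> \<epsilon>(1)] unfolding P_def by metis
    then have "P (LEAST q. P q)" by (rule LeastI_ex)
    then obtain p q where pq: "on_cone p q" "defect \<alpha> p q < \<epsilon>" and q: "q = (LEAST q. P q)"
      unfolding P_def by blast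
    have min: "q \<le> q'" if "on_cone p' q'" "defect \<alpha> p' q' < \<epsilon>" for p' q'
      unfolding q by (rule Least_le) (use that in \<open>auto simp: P_def\<close>)
    have q0: "q > 0" using pq(1) by (simp add: on_cone_def)
    have "real q * defect \<alpha> p q \<le> K\<^sup>2"
      unfolding K_def by (rule minimal_defect_bound[OF \<alpha> \<epsilon>(2) pq min])
    then have "2 * defect \<alpha> p q / real q \<le> 2 * K\<^sup>2 / (real q)\<^sup>2"
      using q0 by (simp add: field_simps power2_eq_square)
    \<comment> \<open>The constant \<open>2 * K\<close> exceeds \<open>sqrt 2 * K\<close>, which
      makes the inequality strict.\<close>
    also have "\<dots> < (2 * K / real q)\<^sup>2"
      using q0 K by (simp add: power_divide power_mult_distrib divide_strict_right_mono)
    finally have "norm (\<alpha> - ratpoint p q) < 2 * K / real q"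
      unfolding norm_diff_ratpoint[OF pq(1) \<alpha>(1), symmetric]
      by (rule power2_less_imp_less) (use K in simp)
    then have "infnorm (\<alpha> - ratpoint p q) < 2 * K / real q"
      using infnorm_le_norm le_less_trans by blast
    then have "defect \<alpha> p q \<in> D"
      using minimal_primitive[OF \<alpha> pq min] on_cone_ratpoint_sphere[OF pq(1)] pq(1)
      unfolding D_def by force
    then show False using \<epsilon>(3) pq(2) by fastforce
  qed
  then show ?thesis using K by (intro exI[of _ "2 * K"]) auto
qed

end
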